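(* The category of augmented ball spaces (with ball continuous functions as morphisms) is topological.
   Context: A ball space is a pair $(X,\mathcal{B})$ where $X$ is a nonempty set and $\mathcal{B}$ is a nonempty set of nonempty subsets of $X$. An augmented ball space is a pair $(X,\mathcal{A})$ such that either $\mathcal{A}=\mathcal{B}\cup\{\emptyset,X\}$ for some ball space $(X,\mathcal{B})$, or $X$ is an arbitrary (possibly empty) set and $\mathcal{A}=\{\emptyset,X\}$. A function $f:X\to X'$ is ball continuous from $(X,\mathcal{A})$ to $(X',\mathcal{A}')$ if $f^{-1}(A')\in\mathcal{A}$ for all $A'\in\mathcal{A}'$. The category of augmented ball spaces has all augmented ball spaces as objects and the ball continuous functions between them as morphisms. A category $\mathbf{C}$ whose objects are sets with a structure, $(X,\xi)$, and whose morphisms are certain functions between the underlying sets, is called topological if: (1) For every set $X$ and every family $(f_i,(X_i,\xi_i))_{i\in I}$, indexed by a class $I$, of $\mathbf{C}$-objects $(X_i,\xi_i)$ and functions $f_i:X\to X_i$, there exists a unique initial $\mathbf{C}$-object $(X,\xi)$ on the set $X$, i.e. an object $(X,\xi)$ such that for all $\mathbf{C}$-objects $(Y,\eta)$ and all maps $g:Y\to X$: $g$ is a morphism $(Y,\eta)\to(X,\xi)$ if and only if for all $i\in I$, $f_i\circ g$ is a morphism $(Y,\eta)\to(X_i,\xi_i)$. (2) (Fibre-smallness) For every set $X$, the class of $\mathbf{C}$-objects on $X$ is a set. (3) On every set with at most one element there exists exactly one $\mathbf{C}$-structure. *)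

theory Defs
  imports "HOL-Library.FuncSet" "HOL-Library.Equipollence"
begin

text \<open>
  The type \<^typ>\<open>'u\<close> is the universe of points, and every \<^typ>\<open>'u set\<close> is a class. Which classes
  count as sets is given by a predicate \<open>is_set\<close>, and a predicate \<open>is_set2\<close> says the same for
  classes of families of subsets of \<^typ>\<open>'u\<close>. The only principle imposed is that the power set
  of the power set of a set is a set, and so is every part of it. Two typical instances are
  proved below: everything is a set, and a set is a class of cardinality less than
  that of the universe (assumed to be a strong limit), as in a Grothendieck universe.
\<close>

definition set_universe :: "('u set \<Rightarrow> bool) \<Rightarrow> ('u set set set \<Rightarrow> bool) \<Rightarrow> bool" where
  "set_universe is_set is_set2 \<longleftrightarrow>
     (\<forall>X. is_set X \<longrightarrow> is_set2 (Pow (Pow X))) \<and>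
     (\<forall>F G. is_set2 G \<and> F \<subseteq> G \<longrightarrow> is_set2 F)"

text \<open>
  A category of structured sets. Objects are pairs \<open>(X, \<xi>)\<close>. Functions between carriers are
  represented by the elements of \<^term>\<open>X \<rightarrow>\<^sub>E Y\<close>, so that equality of morphisms is equality
  on the carrier.
\<close>

record ('u, 's) structured_sets =
  Obj :: "('u set \<times> 's) set"
  Mor :: "'u set \<times> 's \<Rightarrow> 'u set \<times> 's \<Rightarrow> ('u \<Rightarrow> 'u) set"

text \<open>
  Associativity and the unit laws hold for composition of functions, so only closure has to be
  required.
\<close>

definition category_of_structured_sets ::
    "('u set \<Rightarrow> bool) \<Rightarrow> ('u, 's) structured_sets \<Rightarrow> bool" where
  "category_of_structured_sets is_set C \<longleftrightarrow>
     (\<forall>A\<in>Obj C. is_set (fst A)) \<and>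
     (\<forall>A\<in>Obj C. \<forall>B\<in>Obj C. Mor C A B \<subseteq> fst A \<rightarrow>\<^sub>E fst B) \<and>
     (\<forall>A\<in>Obj C. (\<lambda>x\<in>fst A. x) \<in> Mor C A A) \<and>
     (\<forall>A\<in>Obj C. \<forall>B\<in>Obj C. \<forall>D\<in>Obj C. \<forall>f\<in>Mor C A B. \<forall>g\<in>Mor C B D.
        compose (fst A) g f \<in> Mor C A D)"

definition initial_structure ::
    "('u, 's) structured_sets \<Rightarrow> 'u set \<Rightarrow> 'i set \<Rightarrow> ('i \<Rightarrow> 'u \<Rightarrow> 'u) \<Rightarrow> ('i \<Rightarrow> 'u set \<times> 's) \<Rightarrow> 's \<Rightarrow> bool" where
  "initial_structure C X I f A \<xi> \<longleftrightarrow>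
     (X, \<xi>) \<in> Obj C \<and>
     (\<forall>Y \<eta>. (Y, \<eta>) \<in> Obj C \<longrightarrow> (\<forall>g \<in> Y \<rightarrow>\<^sub>E X.
        g \<in> Mor C (Y, \<eta>) (X, \<xi>) \<longleftrightarrow> (\<forall>i\<in>I. compose Y (f i) g \<in> Mor C (Y, \<eta>) (A i))))"

text \<open>
  The index class of a family is any class of elements of any type \<^typ>\<open>'i\<close>; it need not be a
  set. The predicate \<open>is_small\<close> says which classes of structures are sets.
\<close>

definition topological ::
    "'i itself \<Rightarrow> ('u set \<Rightarrow> bool) \<Rightarrow> ('s set \<Rightarrow> bool) \<Rightarrow> ('u, 's) structured_sets \<Rightarrow> bool" where
  "topological TI is_set is_small C \<longleftrightarrow>
     category_of_structured_sets is_set C \<and>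
     (\<forall>X (I :: 'i set) f A.
        is_set X \<and> (\<forall>i\<in>I. A i \<in> Obj C \<and> f i \<in> X \<rightarrow>\<^sub>E fst (A i)) \<longrightarrow>
        (\<exists>!\<xi>. initial_structure C X I f A \<xi>)) \<and>
     (\<forall>X. is_set X \<longrightarrow> is_small {\<xi>. (X, \<xi>) \<in> Obj C}) \<and>
     (\<forall>X. is_set X \<and> (\<forall>x\<in>X. \<forall>y\<in>X. x = y) \<longrightarrow> (\<exists>!\<xi>. (X, \<xi>) \<in> Obj C))"

definition ball_space :: "'u set \<Rightarrow> 'u set set \<Rightarrow> bool" where
  "ball_space X \<B> \<longleftrightarrow> X \<noteq> {} \<and> \<B> \<noteq> {} \<and> (\<forall>B\<in>\<B>. B \<subseteq> X \<and> B \<noteq> {})"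

definition augmented_ball_space :: "'u set \<Rightarrow> 'u set set \<Rightarrow> bool" where
  "augmented_ball_space X \<A> \<longleftrightarrow>
     (\<exists>\<B>. ball_space X \<B> \<and> \<A> = \<B> \<union> {{}, X}) \<or> \<A> = {{}, X}"

definition ball_continuous ::
    "'u set \<times> 'u set set \<Rightarrow> 'u set \<times> 'u set set \<Rightarrow> ('u \<Rightarrow> 'u) \<Rightarrow> bool" where
  "ball_continuous S T f \<longleftrightarrow>
     f \<in> fst S \<rightarrow>\<^sub>E fst T \<and> (\<forall>A\<in>snd T. f -` A \<inter> fst S \<in> snd S)"

definition augmented_ball_spaces ::
    "('u set \<Rightarrow> bool) \<Rightarrow> ('u, 'u set set) structured_sets" where
  "augmented_ball_spaces is_set =
     \<lparr>Obj = {(X, \<A>). is_set X \<and> augmented_ball_space X \<A>},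
      Mor = (\<lambda>S T. {f. ball_continuous S T f})\<rparr>"

lemma set_universe_all: "set_universe (\<lambda>_. True) (\<lambda>_. True)"
  by (simp add: set_universe_def)

lemma set_universe_strong_limit:
  assumes strong_limit: "\<And>X :: 'u set. X \<prec> (UNIV :: 'u set) \<Longrightarrow> Pow X \<prec> (UNIV :: 'u set)"
  shows "set_universe (\<lambda>X :: 'u set. X \<prec> (UNIV :: 'u set)) (\<lambda>F. F \<prec> (UNIV :: 'u set))"
proof -
  have "Pow (Pow X) \<prec> (UNIV :: 'u set)" if X: "X \<prec> (UNIV :: 'u set)" for X :: "'u set"
  proof -
    have P: "Pow X \<prec> (UNIV :: 'u set)"
      by (rule strong_limit[OF X])
    then obtain h :: "'u set \<Rightarrow> 'u" where h: "inj_on h (Pow X)"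
      by (auto simp: lesspoll_def lepoll_def)
    then have e: "h ` Pow X \<approx> Pow X"
      by (rule inj_on_image_eqpoll_self)
    have "Pow (h ` Pow X) \<prec> (UNIV :: 'u set)"
      by (rule strong_limit[OF eq_lesspoll_trans[OF e P]])
    moreover have "Pow (Pow X) \<approx> Pow (h ` Pow X)"
      using bij_betw_Pow[OF inj_on_imp_bij_betw[OF h]] by (auto simp: eqpoll_def)
    ultimately show ?thesis
      by (rule eq_lesspoll_trans[rotated])
  qed
  then show ?thesis
    unfolding set_universe_def using lesspoll_trans1 subset_imp_lepoll by metis
qed

end

theory Submission
  imports Defs
begin

text \<open>An augmented ball structure on \<open>X\<close> is nothing but a family of subsets of
  \<open>X\<close> containing \<open>{}\<close> and \<open>X\<close>
  (\<open>augmented_ball_space_iff\<close>). Morphisms are defined by preimages, as for topologies,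
  but no closure under unions or intersections is demanded. So the preimages of all balls under the
  maps \<open>f i\<close>, together with \<open>{}\<close> and \<open>X\<close>, already form the
  initial structure (\<open>initial_structure_augmented_ball_spaces\<close>). Uniqueness is
  antisymmetry of inclusion: the identity is a morphism both ways between two initial structures,
  and its continuity means that one structure contains the other
  (\<open>ball_continuous_id\<close>). The fibre over \<open>X\<close> lies in
  \<open>Pow (Pow X)\<close>, and if \<open>X\<close> has at most one element, its only subsets are
  \<open>{}\<close> and \<open>X\<close>.\<close>

lemma augmented_ball_space_iff:
  "augmented_ball_space X \<A> \<longleftrightarrow> \<A> \<subseteq> Pow X \<and> {} \<in> \<A> \<and> X \<in> \<A>"
proof
  assume "augmented_ball_space X \<A>"
  then show "\<A> \<subseteq> Pow X \<and> {} \<in> \<A> \<and> X \<in> \<A>"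
    by (auto simp: augmented_ball_space_def ball_space_def)
next
  assume A: "\<A> \<subseteq> Pow X \<and> {} \<in> \<A> \<and> X \<in> \<A>"
  show "augmented_ball_space X \<A>"
  proof (cases "X = {}")
    case True
    \<comment> \<open>The empty set carries no ball space, so only the second alternative of the
      definition is available.\<close>
    with A have "\<A> = {{}, X}" by auto
    then show ?thesis by (simp add: augmented_ball_space_def)
  next
    case False
    \<comment> \<open>Balls must be nonempty, so \<open>{}\<close> is removed; the nonempty
      \<open>X\<close> stays and keeps the family nonempty.\<close>
    with A have "ball_space X (\<A> - {{}})" and "\<A> = (\<A> - {{}}) \<union> {{}, X}"
      by (auto simp: ball_space_def)
    then show ?thesis unfolding augmented_ball_space_def by blast
  qed
qed

lemma Obj_augmented_ball_spaces [simp]: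
  "(X, \<A>) \<in> Obj (augmented_ball_spaces is_set) \<longleftrightarrow>
     is_set X \<and> \<A> \<subseteq> Pow X \<and> {} \<in> \<A> \<and> X \<in> \<A>"
  by (simp add: augmented_ball_spaces_def augmented_ball_space_iff)

lemma Mor_augmented_ball_spaces [simp]:
  "f \<in> Mor (augmented_ball_spaces is_set) S T \<longleftrightarrow> ball_continuous S T f"
  by (simp add: augmented_ball_spaces_def)

text \<open>Functions are total in the logic, so preimages are cut down to carriers. The inner cut
  with \<open>Y\<close> leaves exactly the set that continuity of \<open>g\<close> places in the
  structure on \<open>Y\<close>.\<close>

lemma compose_vimage_Int:
  assumes "f \<in> X \<rightarrow> Y"
  shows "compose X g f -` A \<inter> X = f -` (g -` A \<inter> Y) \<inter> X"
  using assms by (auto simp: compose_def)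

text \<open>Turns identity morphisms into comparisons of structures: if all members of \<B> lie in
  \<open>X\<close>, the condition says that \<A> contains \<B>.\<close>

lemma ball_continuous_id:
  "ball_continuous (X, \<A>) (X, \<B>) (\<lambda>x\<in>X. x) \<longleftrightarrow> (\<forall>B\<in>\<B>. B \<inter> X \<in> \<A>)"
proof -
  have "(\<lambda>x\<in>X. x) -` B \<inter> X = B \<inter> X" for B
    by auto
  then show ?thesis
    by (simp add: ball_continuous_def)
qed

lemma ball_continuous_compose:
  assumes "ball_continuous S T f" "ball_continuous T U g"
  shows "ball_continuous S U (compose (fst S) g f)"
proof -
  have f: "f \<in> fst S \<rightarrow> fst T" and g: "g \<in> fst T \<rightarrow> fst U"
    using assms by (auto simp: ball_continuous_def)
  have "compose (fst S) g f \<in> fst S \<rightarrow>\<^sub>E fst U"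
    using f g by (auto simp: compose_def)
  then show ?thesis
    \<comment> \<open>\<open>vimage_Int\<close> would split the preimage of the intersection, which
      is the member of \<open>snd T\<close> that continuity of \<open>f\<close> is applied
      to.\<close>
    using assms by (simp add: ball_continuous_def compose_vimage_Int[OF f] del: vimage_Int)
qed

lemma category_augmented_ball_spaces:
  "category_of_structured_sets is_set (augmented_ball_spaces is_set)"
  unfolding category_of_structured_sets_def
proof (intro conjI ballI)
  fix A assume A: "A \<in> Obj (augmented_ball_spaces is_set)"
  obtain X \<A> where XA: "A = (X, \<A>)" by (cases A)
  show "is_set (fst A)"
    using A by (simp add: XA)
  have "B \<inter> X = B" if "B \<in> \<A>" for B
    using A that by (auto simp: XA)
  then show "(\<lambda>x\<in>fst A. x) \<in> Mor (augmented_ball_spaces is_set) A A"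
    by (simp add: XA ball_continuous_id)
next
  fix A B :: "'a set \<times> 'a set set"
  show "Mor (augmented_ball_spaces is_set) A B \<subseteq> fst A \<rightarrow>\<^sub>E fst B"
    by (auto simp: ball_continuous_def)
next
  fix A B D f g
  assume "f \<in> Mor (augmented_ball_spaces is_set) A B"
    and "g \<in> Mor (augmented_ball_spaces is_set) B D"
  then show "compose (fst A) g f \<in> Mor (augmented_ball_spaces is_set) A D"
    by (simp add: ball_continuous_compose)
qed

text \<open>
  The sets \<open>{}\<close> and \<open>X\<close> are added explicitly because the index class may be empty.
\<close>

lemma initial_structure_augmented_ball_spaces:
  assumes X: "is_set X"
    and fam: "\<And>i. i \<in> I \<Longrightarrow> f i \<in> X \<rightarrow>\<^sub>E fst (A i)"
  shows "initial_structure (augmented_ball_spaces is_set) X I f A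
           ({{}, X} \<union> {f i -` B \<inter> X | i B. i \<in> I \<and> B \<in> snd (A i)})"
    (is "initial_structure _ X I f A ?\<xi>")
  unfolding initial_structure_def
proof (intro conjI allI impI ballI)
  show "(X, ?\<xi>) \<in> Obj (augmented_ball_spaces is_set)"
    using X by auto
next
  fix Y \<eta> g
  assume Y: "(Y, \<eta>) \<in> Obj (augmented_ball_spaces is_set)" and g: "g \<in> Y \<rightarrow>\<^sub>E X"
  then have gX: "g \<in> Y \<rightarrow> X" by auto
  have triv: "g -` {} \<inter> Y \<in> \<eta>" "g -` X \<inter> Y \<in> \<eta>"
  proof -
    have "g -` X \<inter> Y = Y" using g by auto
    then show "g -` X \<inter> Y \<in> \<eta>" using Y by simp
  qed (use Y in simp)
  have comp: "compose Y (f i) g \<in> Y \<rightarrow>\<^sub>E fst (A i)" if "i \<in> I" for i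
    using fam[OF that] gX by (auto simp: compose_def)
  \<comment> \<open>By \<open>triv\<close>, the members \<open>{}\<close> and \<open>X\<close>
    impose no condition on \<open>g\<close>; only the preimages under the \<open>f i\<close> remain
    to be tested.\<close>
  have "ball_continuous (Y, \<eta>) (X, ?\<xi>) g \<longleftrightarrow>
      (\<forall>i\<in>I. \<forall>B\<in>snd (A i). g -` (f i -` B \<inter> X) \<inter> Y \<in> \<eta>)"
    using g triv unfolding ball_continuous_def fst_conv snd_conv by blast
  also have "\<dots> \<longleftrightarrow> (\<forall>i\<in>I. ball_continuous (Y, \<eta>) (A i) (compose Y (f i) g))"
    using comp by (simp add: ball_continuous_def compose_vimage_Int[OF gX] del: vimage_Int)
  finally show "g \<in> Mor (augmented_ball_spaces is_set) (Y, \<eta>) (X, ?\<xi>) \<longleftrightarrow>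
      (\<forall>i\<in>I. compose Y (f i) g \<in> Mor (augmented_ball_spaces is_set) (Y, \<eta>) (A i))"
    by simp
qed

text \<open>
  Testing both initiality conditions on the identity shows that it is a morphism from the one
  structure to the other.
\<close>

lemma initial_structure_id_morphism:
  assumes C: "category_of_structured_sets is_set C"
    and init: "initial_structure C X I f A \<xi>" "initial_structure C X I f A \<xi>'"
  shows "(\<lambda>x\<in>X. x) \<in> Mor C (X, \<xi>) (X, \<xi>')"
proof -
  have obj: "(X, \<xi>) \<in> Obj C"
    using init(1) by (simp add: initial_structure_def)
  have id: "(\<lambda>x\<in>X. x) \<in> X \<rightarrow>\<^sub>E X"
    by auto
  have "(\<lambda>x\<in>X. x) \<in> Mor C (X, \<xi>) (X, \<xi>)"
    using C obj by (force simp: category_of_structured_sets_def)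
  then have "\<forall>i\<in>I. compose X (f i) (\<lambda>x\<in>X. x) \<in> Mor C (X, \<xi>) (A i)"
    using init(1) obj id unfolding initial_structure_def by blast
  then show ?thesis
    using init(2) obj id unfolding initial_structure_def by blast
qed

text \<open>Pulling a member of \<xi>' back along the identity morphism from \<xi> to \<xi>' returns
  that member. Exchanging the two structures then gives equality.\<close>

lemma initial_structure_augmented_ball_spaces_subset:
  assumes "initial_structure (augmented_ball_spaces is_set) X I f A \<xi>"
    and "initial_structure (augmented_ball_spaces is_set) X I f A \<xi>'"
  shows "\<xi>' \<subseteq> \<xi>"
proof
  fix B assume B: "B \<in> \<xi>'"
  have "ball_continuous (X, \<xi>) (X, \<xi>') (\<lambda>x\<in>X. x)"
    using initial_structure_id_morphism[OF category_augmented_ball_spaces assms] by simp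
  then have "B \<inter> X \<in> \<xi>"
    using B by (simp add: ball_continuous_id)
  moreover have "B \<subseteq> X"
    using assms(2) B by (auto simp: initial_structure_def)
  ultimately show "B \<in> \<xi>"
    by (simp add: Int_absorb2)
qed

theorem theorem2:
  fixes is_set :: "'u set \<Rightarrow> bool" and is_set2 :: "'u set set set \<Rightarrow> bool"
  assumes "set_universe is_set is_set2"
  shows "topological TYPE('i) is_set is_set2 (augmented_ball_spaces is_set)"
  unfolding topological_def
proof (intro conjI allI impI)
  show "category_of_structured_sets is_set (augmented_ball_spaces is_set)"
    by (rule category_augmented_ball_spaces)
next
  fix X and I :: "'i set" and f :: "'i \<Rightarrow> 'u \<Rightarrow> 'u" and A :: "'i \<Rightarrow> 'u set \<times> 'u set set"
  assume "is_set X \<and> (\<forall>i\<in>I. A i \<in> Obj (augmented_ball_spaces is_set) \<and> f i \<in> X \<rightarrow>\<^sub>E fst (A i))"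
  then have X: "is_set X" and fam: "\<And>i. i \<in> I \<Longrightarrow> f i \<in> X \<rightarrow>\<^sub>E fst (A i)"
    by auto
  show "\<exists>!\<xi>. initial_structure (augmented_ball_spaces is_set) X I f A \<xi>"
  proof (rule ex_ex1I)
    show "\<exists>\<xi>. initial_structure (augmented_ball_spaces is_set) X I f A \<xi>"
      using initial_structure_augmented_ball_spaces[where is_set = is_set, OF X fam] by (rule exI)
  next
    fix \<xi> \<xi>'
    assume "initial_structure (augmented_ball_spaces is_set) X I f A \<xi>"
      and "initial_structure (augmented_ball_spaces is_set) X I f A \<xi>'"
    then show "\<xi> = \<xi>'"
      by (metis initial_structure_augmented_ball_spaces_subset subset_antisym)
  qed
next
  fix X assume "is_set X"
  \<comment> \<open>This is the bound for fibre-smallness: \<open>set_universe\<close> makes every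
    part of \<open>Pow (Pow X)\<close> a set.\<close>
  moreover have "{\<xi>. (X, \<xi>) \<in> Obj (augmented_ball_spaces is_set)} \<subseteq> Pow (Pow X)"
    by auto
  ultimately show "is_set2 {\<xi>. (X, \<xi>) \<in> Obj (augmented_ball_spaces is_set)}"
    using assms unfolding set_universe_def by blast
next
  fix X assume X: "is_set X \<and> (\<forall>x\<in>X. \<forall>y\<in>X. x = y)"
  \<comment> \<open>With at most one point there is no room for a further ball, so the two
    obligatory members exhaust every structure.\<close>
  have subset_cases: "B = {} \<or> B = X" if "B \<subseteq> X" for B
    using X that by (metis ex_in_conv subsetD subsetI subset_antisym)
  show "\<exists>!\<xi>. (X, \<xi>) \<in> Obj (augmented_ball_spaces is_set)"
  proof (rule ex1I[of _ "{{}, X}"])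
    show "(X, {{}, X}) \<in> Obj (augmented_ball_spaces is_set)"
      using X by simp
  next
    fix \<xi> assume "(X, \<xi>) \<in> Obj (augmented_ball_spaces is_set)"
    then have "\<xi> \<subseteq> Pow X" "{} \<in> \<xi>" "X \<in> \<xi>"
      by simp_all
    then show "\<xi> = {{}, X}"
      using subset_cases by blast
  qed
qed

end
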